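(* Let $n \geq 2$ be an integer. Consider independent, identically distributed random variables $X_1, \dots, X_n$ taking values in the non-negative integers with $\mathbb{E}[X_i] = 1$. Over all such common distributions, the minimum of $P\left(\sum_{i=1}^n X_i \leq n\right)$ equals $\left(1 - \frac{1}{n+1}\right)^n$, and it is attained by the distribution with $P(X_i = 0) = 1 - \frac{1}{n+1}$ and $P(X_i = n+1) = \frac{1}{n+1}$. *)

theory Defs
  imports "HOL-Probability.Probability"
begin

definition iid_sum_pmf :: "nat \<Rightarrow> nat pmf \<Rightarrow> nat pmf" where
  "iid_sum_pmf n p = map_pmf (\<lambda>f. \<Sum>i<n. f i) (Pi_pmf {..<n} 0 (\<lambda>_. p))"

definition nat_pmf_mean :: "nat pmf \<Rightarrow> ennreal" where
  "nat_pmf_mean p = (\<integral>\<^sup>+ x. ennreal (real x) \<partial>measure_pmf p)"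

definition extremal_pmf :: "nat \<Rightarrow> nat pmf" where
  "extremal_pmf n = map_pmf (\<lambda>b. if b then n + 1 else 0) (bernoulli_pmf (1 / real (n + 1)))"

end

(* Write M = N + 1 and let S be a sum of m <= N independent mean-1 summands. With the other
   summands fixed, P(S <= N) is the expectation of a function of one summand X. If a line through
   the graph at x = 0 lies below it, E X = 1 bounds that expectation by the value of the line at 1,
   so the minimum is attained at laws k * Bernoulli(1/k), k >= 1. Integrality enters here: 0 is the
   only value below the mean. A summand with k = 1 is constant and reduces (m, N) to (m - 1, N - 1).

   For k >= 2 let G = P(S <= N), c = E (M - S)^+ and R = c / G, so 1 <= R <= M. Adding a summand
   lowers c by at most the old value of G. Some summand can be deleted without decreasing
   E[M - S | S <= N]: deleting summand i amounts to conditioning on X_i = 0, and the covariances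
   Cov(S, X_i | S <= N) add up to a variance, so one of them is nonnegative. Deleting summands one
   by one in this way keeps c / G >= R throughout, so, read backwards, each step takes c from x to
   no less than x - min(1, x / R). Starting from c = M this gives c >= R (1 - 1/M)^m after m <= N
   steps, that is, G >= (1 - 1/M)^m. *)
theory Submission
  imports Defs
begin

section \<open>Expectations over product distributions\<close>

lemma expectation_bind_pmf_bounded:
  fixes f :: "'b \<Rightarrow> real"
  assumes "\<And>y. \<bar>f y\<bar> \<le> B"
  shows "measure_pmf.expectation (bind_pmf p q) f
    = measure_pmf.expectation p (\<lambda>x. measure_pmf.expectation (q x) f)"
  unfolding measure_pmf_bind
  by (rule integral_bind[where K = "count_space UNIV" and B = B and B' = 1])
     (use assms in \<open>auto simp: measure_pmf.finite_measure_axioms measure_pmf.emeasure_space_1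
        space_subprob_algebra intro: measure_pmf.subprob_space_axioms\<close>)

lemma expectation_Pi_pmf_insert:
  fixes f :: "('i \<Rightarrow> 'a) \<Rightarrow> real"
  assumes "finite I" "i \<notin> I" "\<And>w. \<bar>f w\<bar> \<le> B"
  shows "measure_pmf.expectation (Pi_pmf (insert i I) d p) f
    = measure_pmf.expectation (p i)
        (\<lambda>x. measure_pmf.expectation (Pi_pmf I d p) (\<lambda>w. f (w(i := x))))"
  using assms
  by (simp add: Pi_pmf_insert' expectation_bind_pmf_bounded[where B = B] del: integral_map_pmf)

section \<open>A power inequality and the iteration of \<open>gap_step\<close>\<close>

text \<open>Factoring \<open>1 - 1 / R\<close> as \<open>(1 - x) * (1 - 1 / P)\<close> reduces the
  claim to \<open>R / P \<le> (1 - x) ^ a\<close>, which is Bernoulli's inequality once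
  \<open>a * x \<le> (P - R) / P\<close>; the hypothesis \<open>a + 1 \<le> R\<close> supplies
  that.\<close>

lemma power_gap_inequality:
  fixes R P :: real
  assumes "real a + 1 \<le> R" "R \<le> P"
  shows "(P - 1) * (1 - 1 / R) ^ a \<ge> R * (1 - 1 / P) ^ Suc a"
proof (cases "P = 1")
  case True
  then show ?thesis using assms by simp
next
  case False
  define x where "x = (P - R) / (R * (P - 1))"
  have pos: "R > 0" "P > 0" "P > 1" "R \<ge> 1"
    using assms False by auto
  have x0: "x \<ge> 0" using pos assms by (simp add: x_def)
  have eq: "(1 - 1 / R) = (1 - x) * (1 - 1 / P)"
  proof -
    have "P - 1 \<noteq> 0" "R \<noteq> 0" "P \<noteq> 0" using pos by auto
    then show ?thesis by (simp add: x_def divide_simps) algebra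
  qed
  have x1: "x \<le> 1"
    using eq pos by (smt (verit) divide_le_eq_1_pos mult_neg_pos zero_less_divide_1_iff divide_less_eq_1_pos)
  have "real a * x \<le> (P - R) / P"
  proof -
    have "real a * P \<le> (R - 1) * P" using assms pos by (intro mult_right_mono) auto
    also have "\<dots> \<le> R * (P - 1)" using assms by (simp add: algebra_simps)
    finally have "real a / (R * (P - 1)) \<le> 1 / P"
      using pos by (simp add: divide_simps)
    then have "(real a / (R * (P - 1))) * (P - R) \<le> (1 / P) * (P - R)"
      using assms by (intro mult_right_mono) auto
    then show ?thesis by (simp add: x_def)
  qed
  then have "R / P \<le> 1 + real a * (- x)"
    using pos by (simp add: diff_divide_distrib)
  also have "\<dots> \<le> (1 + (- x)) ^ a"
    using x1 by (intro Bernoulli_inequality) auto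
  finally have "R / P \<le> (1 - x) ^ a" by simp
  then have "R \<le> P * (1 - x) ^ a" using pos by (simp add: divide_simps mult.commute)
  then have "R * ((1 - 1 / P) ^ a * (P - 1) / P) \<le> (P * (1 - x) ^ a) * ((1 - 1 / P) ^ a * (P - 1) / P)"
    using pos by (intro mult_right_mono) auto
  also have "\<dots> = (P - 1) * (1 - 1 / R) ^ a"
    using pos by (simp add: eq power_mult_distrib)
  also have "R * ((1 - 1 / P) ^ a * (P - 1) / P) = R * (1 - 1 / P) ^ Suc a"
    using pos by (simp add: field_simps)
  finally show ?thesis .
qed

text \<open>A lower bound for the mean gap after adding a summand to a sum with mean gap
  \<open>x\<close>: the loss is at most a probability that is bounded by both 1 and
  \<open>x / R\<close>.\<close>

definition gap_step :: "real \<Rightarrow> real \<Rightarrow> real" where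
  "gap_step R x = x - min 1 (x / R)"

lemma gap_step_mono:
  assumes "R \<ge> 1" "x \<le> y"
  shows "gap_step R x \<le> gap_step R y"
proof -
  \<comment> \<open>Both branches are affine with nonnegative slope because
    \<open>R \<ge> 1\<close>.\<close>
  have eq: "gap_step R z = max (z - 1) (z * (1 - 1 / R))" for z
    by (simp add: gap_step_def min_def max_def algebra_simps)
  have "x * (1 - 1 / R) \<le> y * (1 - 1 / R)"
    using assms by (intro mult_right_mono) auto
  then show ?thesis using assms(2) by (auto simp: eq max_def)
qed

text \<open>On \<open>[0, R]\<close> the minimum is \<open>x / R\<close>, so each step multiplies by
  \<open>1 - 1 / R\<close> and stays in the interval.\<close>

lemma gap_step_iterate_below:
  assumes "R \<ge> 1" "0 \<le> x" "x \<le> R"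
  shows "(gap_step R ^^ a) x = x * (1 - 1 / R) ^ a"
  using assms(2,3)
proof (induction a arbitrary: x)
  case (Suc a)
  have "gap_step R x = x * (1 - 1 / R)"
    using Suc.prems assms(1) by (simp add: gap_step_def min_def algebra_simps)
  moreover have "x * (1 - 1 / R) \<le> x * 1" "0 \<le> x * (1 - 1 / R)"
    using Suc.prems assms(1) by (intro mult_left_mono mult_nonneg_nonneg; simp)+
  ultimately show ?case
    using Suc.IH[of "x * (1 - 1 / R)"] Suc.prems by (simp add: funpow_swap1)
qed simp

text \<open>Since \<open>R \<le> M\<close>, the first step leads from \<open>M\<close> to
  \<open>M - 1\<close>. If this is still at least \<open>R\<close>, the induction hypothesis for
  \<open>M - 1\<close> applies; otherwise the remaining orbit is geometric.\<close>

lemma gap_step_iterate_ge: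
  assumes "R \<ge> 1" "R \<le> real M" "m < M"
  shows "R * (1 - 1 / real M) ^ m \<le> (gap_step R ^^ m) (real M)"
  using assms(2,3)
proof (induction m arbitrary: M)
  case (Suc m)
  have M: "real (M - 1) = real M - 1" using Suc.prems by simp
  have "gap_step R (real M) = real M - 1"
    using Suc.prems assms(1) by (simp add: gap_step_def min_def)
  then have it: "(gap_step R ^^ Suc m) (real M) = (gap_step R ^^ m) (real (M - 1))"
    by (simp only: funpow_Suc_right o_apply M)
  have m: "real m + 1 \<le> real M - 1" using Suc.prems by linarith
  show ?case
  proof (cases "R \<le> real M - 1")
    case True
    have pos: "real M - 1 > 0" using m by linarith
    \<comment> \<open>Here \<open>power_gap_inequality\<close> is used with \<open>M - 1\<close> for
      \<open>R\<close> and \<open>M\<close> for \<open>P\<close>, which makes the outer factors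
      equal.\<close>
    have "(real M - 1) * (1 - 1 / real M) ^ Suc m \<le> (real M - 1) * (1 - 1 / (real M - 1)) ^ m"
      using m by (intro power_gap_inequality) auto
    then have "(1 - 1 / real M) ^ Suc m \<le> (1 - 1 / real (M - 1)) ^ m"
      using pos M by (metis mult_le_cancel_left_pos)
    then have "R * (1 - 1 / real M) ^ Suc m \<le> R * (1 - 1 / real (M - 1)) ^ m"
      using assms(1) by (intro mult_left_mono) auto
    also have "\<dots> \<le> (gap_step R ^^ m) (real (M - 1))"
      using Suc.IH[of "M - 1"] True Suc.prems M by auto
    finally show ?thesis using it by simp
  next
    case False
    then have "R * (1 - 1 / real M) ^ Suc m \<le> (real M - 1) * (1 - 1 / R) ^ m"
      using m Suc.prems by (intro power_gap_inequality) auto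
    also have "\<dots> = (gap_step R ^^ m) (real (M - 1))"
      using gap_step_iterate_below[of R "real (M - 1)" m] False assms(1) M by auto
    finally show ?thesis using it by simp
  qed
qed simp

section \<open>Two-point laws of mean one and the supporting line\<close>

definition two_point :: "nat \<Rightarrow> nat pmf" where
  "two_point k = map_pmf (\<lambda>b. if b then k else 0) (bernoulli_pmf (1 / real k))"

lemma expectation_two_point:
  fixes f :: "nat \<Rightarrow> real"
  assumes "k \<ge> 1"
  shows "measure_pmf.expectation (two_point k) f = (1 - 1 / real k) * f 0 + f k / real k"
  using assms by (simp add: two_point_def)

lemma set_two_point: "set_pmf (two_point k) \<subseteq> {0, k}"
  by (auto simp: two_point_def)

lemma nat_pmf_mean_two_point:
  assumes "k \<ge> 1"
  shows "nat_pmf_mean (two_point k) = 1"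
proof -
  have "nat_pmf_mean (two_point k) = ennreal (measure_pmf.expectation (two_point k) real)"
    unfolding nat_pmf_mean_def
    by (intro nn_integral_eq_integral integrable_measure_pmf_finite finite_subset[OF set_two_point]) auto
  then show ?thesis using assms by (simp add: expectation_two_point)
qed

lemma expectation_ge_supporting_line:
  fixes f :: "nat \<Rightarrow> real"
  assumes mean: "nat_pmf_mean p = 1"
    and bounded: "\<And>x. \<bar>f x\<bar> \<le> B"
    and two_point: "\<And>k. k \<ge> 1 \<Longrightarrow> measure_pmf.expectation (two_point k) f \<ge> C"
  shows "measure_pmf.expectation p f \<ge> C"
proof -
  have int: "integrable (measure_pmf p) real"
    using mean by (simp add: integrable_iff_bounded nat_pmf_mean_def)
  have exp: "measure_pmf.expectation p real = 1"
    using mean by (simp add: integral_eq_nn_integral nat_pmf_mean_def)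
  \<comment> \<open>For \<open>x \<ge> 1\<close> the bound for \<open>two_point x\<close>,
    multiplied by \<open>x\<close>, says exactly that the line through \<open>(0, f 0)\<close> and
    \<open>(1, C)\<close> is below \<open>f\<close> at \<open>x\<close>.\<close>
  have line: "f 0 + real x * (C - f 0) \<le> f x" for x
  proof (cases "x = 0")
    case False
    then have "C \<le> (1 - 1 / real x) * f 0 + f x / real x"
      using two_point[of x] by (simp add: expectation_two_point)
    then have "real x * C \<le> real x * ((1 - 1 / real x) * f 0 + f x / real x)"
      by (intro mult_left_mono) auto
    also have "\<dots> = (real x - 1) * f 0 + f x" using False by (simp add: field_simps)
    finally show ?thesis by (simp add: algebra_simps)
  qed simp
  have "C = measure_pmf.expectation p (\<lambda>x. f 0 + real x * (C - f 0))"
    using int exp by simp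
  also have "\<dots> \<le> measure_pmf.expectation p f"
  proof (intro integral_mono)
    show "integrable (measure_pmf p) f"
      using bounded by (intro measure_pmf.integrable_const_bound[where B = B]) auto
  qed (use int line in auto)
  finally show ?thesis .
qed

section \<open>Expectations of functions of an independent sum\<close>

text \<open>The laws may differ between indices, since the reduction to two-point laws replaces one
  summand at a time and summands are later deleted.\<close>

definition sum_expectation :: "('i \<Rightarrow> nat pmf) \<Rightarrow> 'i set \<Rightarrow> (nat \<Rightarrow> real) \<Rightarrow> real" where
  "sum_expectation p I g = measure_pmf.expectation (Pi_pmf I 0 p) (\<lambda>w. g (\<Sum>i\<in>I. w i))"

definition sum_le_prob :: "('i \<Rightarrow> nat pmf) \<Rightarrow> 'i set \<Rightarrow> nat \<Rightarrow> real" where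
  "sum_le_prob p I N = sum_expectation p I (\<lambda>s. of_bool (s \<le> N))"

text \<open>The truncated subtraction is intended: it is the positive part of \<open>N + 1 - s\<close>.\<close>
definition mean_gap :: "('i \<Rightarrow> nat pmf) \<Rightarrow> 'i set \<Rightarrow> nat \<Rightarrow> real" where
  "mean_gap p I N = sum_expectation p I (\<lambda>s. real (Suc N - s))"

lemma sum_expectation_empty [simp]: "sum_expectation p {} g = g 0"
  by (simp add: sum_expectation_def)

lemma integrable_Pi_pmf_bounded:
  fixes f :: "_ \<Rightarrow> real"
  assumes "\<And>w. \<bar>f w\<bar> \<le> B"
  shows "integrable (measure_pmf q) f"
  using assms by (intro measure_pmf.integrable_const_bound[where B = B]) auto

lemma sum_fun_upd_insert:
  fixes w :: "'i \<Rightarrow> nat"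
  assumes "finite I" "i \<notin> I"
  shows "(\<Sum>j\<in>insert i I. (w(i := x)) j) = x + (\<Sum>j\<in>I. w j)"
proof -
  have "(\<Sum>j\<in>I. (w(i := x)) j) = (\<Sum>j\<in>I. w j)"
    using assms(2) by (intro sum.cong) auto
  then show ?thesis using assms by simp
qed

lemma sum_expectation_insert:
  fixes g :: "nat \<Rightarrow> real"
  assumes "finite I" "i \<notin> I" "\<And>s. \<bar>g s\<bar> \<le> B"
  shows "sum_expectation p (insert i I) g
    = measure_pmf.expectation (p i) (\<lambda>x. sum_expectation p I (\<lambda>s. g (x + s)))"
proof -
  have "(\<Sum>j\<in>insert i I. (w(i := x)) j) = x + (\<Sum>j\<in>I. w j)" for w :: "'a \<Rightarrow> nat" and x
    using assms(1,2) by (rule sum_fun_upd_insert)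
  then show ?thesis
    using assms unfolding sum_expectation_def
    by (subst expectation_Pi_pmf_insert[where B = B]) auto
qed

lemma sum_expectation_mono:
  assumes "\<And>s. \<bar>g s\<bar> \<le> B" "\<And>s. \<bar>h s\<bar> \<le> B'" "\<And>s. g s \<le> h s"
  shows "sum_expectation p I g \<le> sum_expectation p I h"
  unfolding sum_expectation_def
  using assms by (intro integral_mono integrable_Pi_pmf_bounded[where B = B] integrable_Pi_pmf_bounded[where B = B']) auto

lemma sum_expectation_add:
  assumes "\<And>s. \<bar>g s\<bar> \<le> B" "\<And>s. \<bar>h s\<bar> \<le> B'"
  shows "sum_expectation p I (\<lambda>s. g s + h s) = sum_expectation p I g + sum_expectation p I h"
  unfolding sum_expectation_def
  using assms by (intro Bochner_Integration.integral_add integrable_Pi_pmf_bounded[where B = B]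
      integrable_Pi_pmf_bounded[where B = B']) auto

lemma sum_expectation_cmult:
  "sum_expectation p I (\<lambda>s. a * g s) = a * sum_expectation p I g"
  by (simp add: sum_expectation_def)

lemma sum_expectation_insert_two_point:
  assumes "finite I" "i \<notin> I" "\<And>s. \<bar>g s\<bar> \<le> B" "p i = two_point k" "k \<ge> 1"
  shows "sum_expectation p (insert i I) g
    = (1 - 1 / real k) * sum_expectation p I g + sum_expectation p I (\<lambda>s. g (k + s)) / real k"
  using assms by (simp add: sum_expectation_insert[where B = B] expectation_two_point)

section \<open>Adding and deleting a two-point summand\<close>

text \<open>Fix the sum \<open>s\<close> of the old summands. If \<open>s \<le> N\<close>, the
  positive part is at least its argument, whose mean drops by exactly 1; if \<open>s > N\<close>,
  the gap was already 0.\<close>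

lemma mean_gap_insert_ge:
  assumes "finite I" "i \<notin> I" "p i = two_point k" "k \<ge> 1"
  shows "mean_gap p (insert i I) N \<ge> mean_gap p I N - sum_le_prob p I N"
proof -
  define g :: "nat \<Rightarrow> real" where "g = (\<lambda>s. real (Suc N - s))"
  \<comment> \<open>\<open>h s\<close> is the expected gap after adding the new summand to the
    partial sum \<open>s\<close>.\<close>
  define h where "h = (\<lambda>s. (1 - 1 / real k) * g s + (1 / real k) * g (k + s))"
  have gb: "\<bar>g s\<bar> \<le> real (Suc N)" for s by (simp add: g_def)
  have b1: "\<bar>(1 - 1 / real k) * g s\<bar> \<le> real (Suc N)" for s
  proof -
    have "\<bar>(1 - 1 / real k)\<bar> * \<bar>g s\<bar> \<le> 1 * real (Suc N)"
      using gb[of s] assms(4) by (intro mult_mono) auto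
    then show ?thesis by (simp add: abs_mult)
  qed
  have b2: "\<bar>(1 / real k) * g (k + s)\<bar> \<le> real (Suc N)" for s
  proof -
    have "\<bar>1 / real k\<bar> * \<bar>g (k + s)\<bar> \<le> 1 * real (Suc N)"
      using gb[of "k + s"] assms(4) by (intro mult_mono) auto
    then show ?thesis by (simp add: abs_mult)
  qed
  have hb: "\<bar>h s\<bar> \<le> 2 * real (Suc N)" for s
    using order_trans[OF abs_triangle_ineq add_mono[OF b1 b2]] by (simp add: h_def)
  have "g s \<le> h s + of_bool (s \<le> N)" for s
  proof (cases "s \<le> N")
    case True
    have k: "real k > 0" using assms(4) by simp
    have "real (Suc N) - real s - real k \<le> g (k + s)"
      by (auto simp: g_def)
    then have "(1 / real k) * (real (Suc N) - real s - real k) \<le> (1 / real k) * g (k + s)"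
      by (intro mult_left_mono) auto
    moreover have "(1 / real k) * (real (Suc N) - real s - real k) = (1 / real k) * g s - 1"
      using True k by (simp add: g_def of_nat_diff field_simps)
    ultimately show ?thesis using True by (simp add: h_def algebra_simps)
  next
    case False
    then show ?thesis by (simp add: h_def g_def)
  qed
  moreover have "\<bar>h s + of_bool (s \<le> N)\<bar> \<le> 2 * real (Suc N) + 1" for s
    using hb[of s] by (cases "s \<le> N") (simp_all add: abs_le_iff)
  ultimately have "sum_expectation p I g \<le> sum_expectation p I (\<lambda>s. h s + of_bool (s \<le> N))"
    by (intro sum_expectation_mono[OF gb])
  also have "\<dots> = sum_expectation p I h + sum_le_prob p I N"
    unfolding sum_le_prob_def
    by (rule sum_expectation_add[where B = "2 * real (Suc N)" and B' = 1]) (use hb in auto)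
  also have "sum_expectation p I h = sum_expectation p (insert i I) g"
  proof -
    have "sum_expectation p I h = sum_expectation p I (\<lambda>s. (1 - 1 / real k) * g s)
        + sum_expectation p I (\<lambda>s. (1 / real k) * g (k + s))"
      unfolding h_def by (rule sum_expectation_add[OF b1 b2])
    also have "\<dots> = sum_expectation p (insert i I) g"
      using sum_expectation_insert_two_point[where B = "real (Suc N)" and g = g and p = p, OF assms(1,2) gb assms(3,4)]
      unfolding sum_expectation_cmult by simp
    finally show ?thesis .
  qed
  finally show ?thesis by (simp add: mean_gap_def g_def)
qed

text \<open>The event that coordinate \<open>i\<close> vanishes has probability
  \<open>1 - 1 / k\<close>, is independent of the other coordinates, and on it the total is the sum
  over \<open>I - {i}\<close>.\<close>

lemma expectation_coordinate_zero:
  fixes g :: "nat \<Rightarrow> real"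
  assumes "finite I" "i \<in> I" "\<And>s. \<bar>g s\<bar> \<le> B" "p i = two_point k" "k \<ge> 1"
  shows "measure_pmf.expectation (Pi_pmf I 0 p) (\<lambda>w. of_bool (w i = 0) * g (\<Sum>j\<in>I. w j))
    = (1 - 1 / real k) * sum_expectation p (I - {i}) g"
proof -
  let ?J = "I - {i}"
  have I: "I = insert i ?J" using assms(2) by auto
  have s: "(\<Sum>j\<in>insert i ?J. (w(i := x)) j) = x + (\<Sum>j\<in>?J. w j)" for w :: "'a \<Rightarrow> nat" and x
    using assms(1) by (intro sum_fun_upd_insert) auto
  have B0: "B \<ge> 0" using assms(3)[of 0] by linarith
  have "measure_pmf.expectation (Pi_pmf (insert i ?J) 0 p)
      (\<lambda>w. of_bool (w i = 0) * g (\<Sum>j\<in>insert i ?J. w j))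
    = measure_pmf.expectation (p i) (\<lambda>x. measure_pmf.expectation (Pi_pmf ?J 0 p)
        (\<lambda>w. of_bool ((w(i := x)) i = 0) * g (\<Sum>j\<in>insert i ?J. (w(i := x)) j)))"
    using assms(1,3) B0 by (intro expectation_Pi_pmf_insert[where B = B]) auto
  also have "\<dots> = (1 - 1 / real k) * sum_expectation p ?J g"
    unfolding s assms(4) using assms(5) by (simp add: expectation_two_point sum_expectation_def)
  finally show ?thesis using I by simp
qed

text \<open>If every deletion strictly lowered the ratio of mean gap to probability, adding up the
  resulting inequalities with weights \<open>k i - 1\<close> would contradict Cauchy-Schwarz for
  \<open>g1\<close> and the indicator \<open>g0\<close>.\<close>

lemma ex_removal_increasing_gap_ratio:
  assumes fin: "finite I" and ne: "I \<noteq> {}"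
    and tp: "\<And>i. i \<in> I \<Longrightarrow> p i = two_point (k i)" and k: "\<And>i. i \<in> I \<Longrightarrow> k i \<ge> 2"
  shows "\<exists>i\<in>I. mean_gap p I N * sum_le_prob p (I - {i}) N
    \<le> mean_gap p (I - {i}) N * sum_le_prob p I N"
proof (rule ccontr)
  define g0 :: "nat \<Rightarrow> real" where "g0 = (\<lambda>s. of_bool (s \<le> N))"
  define g1 :: "nat \<Rightarrow> real" where "g1 = (\<lambda>s. real (Suc N - s))"
  define E :: "(('a \<Rightarrow> nat) \<Rightarrow> real) \<Rightarrow> real" where "E = measure_pmf.expectation (Pi_pmf I 0 p)"
  define S where "S = (\<lambda>w::'a \<Rightarrow> nat. \<Sum>i\<in>I. w i)"
  define \<kappa> where "\<kappa> = (\<Sum>i\<in>I. real (k i))"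
  define a b c where "a = E (\<lambda>w. g0 (S w))" and "b = E (\<lambda>w. g1 (S w))"
    and "c = E (\<lambda>w. g1 (S w) ^ 2)"
  define F where "F = (\<lambda>i g. E (\<lambda>w. of_bool (w i = 0) * (g (S w) :: real)))"
  assume "\<not> ?thesis"
  then have less: "mean_gap p (I - {i}) N * sum_le_prob p I N
      < mean_gap p I N * sum_le_prob p (I - {i}) N" if "i \<in> I" for i
    using that by (auto simp: not_le)
  have finS: "finite (set_pmf (Pi_pmf I 0 p))"
    using fin tp set_two_point
    by (subst set_Pi_pmf) (auto intro!: finite_PiE_dflt finite_subset[OF set_two_point])
  have int: "integrable (measure_pmf (Pi_pmf I 0 p)) f" for f :: "_ \<Rightarrow> real"
    using finS by (rule integrable_measure_pmf_finite)
  have F0: "F i g0 = (1 - 1 / real (k i)) * sum_le_prob p (I - {i}) N" if "i \<in> I" for i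
    unfolding F_def E_def S_def sum_le_prob_def g0_def
    using that k[OF that] by (intro expectation_coordinate_zero[where B = 1] fin tp) auto
  have F1: "F i g1 = (1 - 1 / real (k i)) * mean_gap p (I - {i}) N" if "i \<in> I" for i
    unfolding F_def E_def S_def mean_gap_def g1_def
    using that k[OF that] by (intro expectation_coordinate_zero[where B = "real (Suc N)"] fin tp) auto
  have ab: "a = sum_le_prob p I N" "b = mean_gap p I N"
    by (simp_all add: a_def b_def E_def S_def g0_def g1_def sum_le_prob_def mean_gap_def sum_expectation_def)
  have less': "real (k i) * F i g1 * a < real (k i) * F i g0 * b" if "i \<in> I" for i
  proof -
    \<comment> \<open>The weight equals \<open>k i - 1\<close>, which is positive because
      \<open>k i \<ge> 2\<close>.\<close>
    have "real (k i) * (1 - 1 / real (k i)) > 0"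
      using k[OF that] by (simp add: field_simps)
    then have "real (k i) * (1 - 1 / real (k i)) * (mean_gap p (I - {i}) N * a)
      < real (k i) * (1 - 1 / real (k i)) * (b * sum_le_prob p (I - {i}) N)"
      using less[OF that] ab by (intro mult_strict_left_mono) auto
    then show ?thesis using F0[OF that] F1[OF that] by (simp add: mult_ac)
  qed
  have weighted: "(\<Sum>i\<in>I. real (k i) * F i g) = E (\<lambda>w. (\<kappa> - real (S w)) * g (S w))" for g
  proof -
    have "(\<Sum>i\<in>I. real (k i) * F i g) = E (\<lambda>w. \<Sum>i\<in>I. real (k i) * (of_bool (w i = 0) * g (S w)))"
      unfolding E_def F_def using int by (subst Bochner_Integration.integral_sum) auto
    also have "\<dots> = E (\<lambda>w. (\<kappa> - real (S w)) * g (S w))"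
      unfolding E_def
    proof (intro integral_cong_AE)
      show "AE w in measure_pmf (Pi_pmf I 0 p).
          (\<Sum>i\<in>I. real (k i) * (of_bool (w i = 0) * g (S w))) = (\<kappa> - real (S w)) * g (S w)"
      proof (subst AE_measure_pmf_iff, intro ballI)
        fix w assume "w \<in> set_pmf (Pi_pmf I 0 p)"
        then have "w i \<in> set_pmf (p i)" if "i \<in> I" for i
          using that fin by (auto simp: set_Pi_pmf PiE_dflt_def)
        then have "w i \<in> {0, k i}" if "i \<in> I" for i
          using that set_two_point[of "k i"] tp[OF that] by fastforce
        \<comment> \<open>On the support the indicator of a zero coordinate is affine in that
          coordinate, so the weighted sum depends on \<open>w\<close> only through
          \<open>S w\<close>.\<close>
        then have "real (k i) * of_bool (w i = 0) = real (k i) - real (w i)" if "i \<in> I" for i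
          using that by fastforce
        then have "(\<Sum>i\<in>I. real (k i) * of_bool (w i = 0)) = \<kappa> - real (S w)"
          by (simp add: \<kappa>_def S_def sum_subtractf[symmetric])
        then show "(\<Sum>i\<in>I. real (k i) * (of_bool (w i = 0) * g (S w))) = (\<kappa> - real (S w)) * g (S w)"
          by (simp add: sum_distrib_right[symmetric] mult.assoc[symmetric])
      qed
    qed auto
    finally show ?thesis .
  qed
  have "(\<Sum>i\<in>I. real (k i) * F i g1) * a < (\<Sum>i\<in>I. real (k i) * F i g0) * b"
    unfolding sum_distrib_right using less' fin ne by (intro sum_strict_mono) auto
  \<comment> \<open>Split \<open>\<kappa> - S\<close> as
    \<open>(\<kappa> - (N + 1)) + (N + 1 - S)\<close>; the second part turns \<open>g0\<close> into
    \<open>g1\<close>, and below it turns \<open>g1\<close> into its square.\<close>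
  also have "(\<Sum>i\<in>I. real (k i) * F i g0) = E (\<lambda>w. (\<kappa> - real (Suc N)) * g0 (S w) + g1 (S w))"
    unfolding weighted by (rule arg_cong[where f = E]) (auto simp: g0_def g1_def fun_eq_iff algebra_simps of_nat_diff)
  also have "\<dots> = (\<kappa> - real (Suc N)) * a + b"
    unfolding a_def b_def E_def using int by simp
  also have "(\<Sum>i\<in>I. real (k i) * F i g1) = E (\<lambda>w. (\<kappa> - real (Suc N)) * g1 (S w) + g1 (S w) ^ 2)"
  proof -
    have "(\<kappa> - real s) * g1 s = (\<kappa> - real (Suc N)) * g1 s + g1 s ^ 2" for s
      by (cases "s \<le> N") (simp_all add: g1_def of_nat_diff algebra_simps power2_eq_square)
    then show ?thesis unfolding weighted by simp
  qed
  also have "\<dots> = (\<kappa> - real (Suc N)) * b + c"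
    unfolding b_def c_def E_def using int by simp
  \<comment> \<open>The terms \<open>(\<kappa> - (N + 1)) * a * b\<close> on the two sides
    cancel.\<close>
  finally have strict: "a * c < b ^ 2"
    by (simp add: algebra_simps power2_eq_square)
  \<comment> \<open>\<open>g0\<close> is an indicator and \<open>g1 = g1 * g0\<close>, so Cauchy-Schwarz gives \<open>b\<^sup>2 \<le> a * c\<close>.\<close>
  have "0 \<le> E (\<lambda>w. (a * g1 (S w) - b * g0 (S w)) ^ 2)"
    unfolding E_def by (intro Bochner_Integration.integral_nonneg) auto
  also have "\<dots> = E (\<lambda>w. a ^ 2 * g1 (S w) ^ 2 - 2 * a * b * g1 (S w) + b ^ 2 * g0 (S w))"
    by (rule arg_cong[where f = E])
      (auto simp: g0_def g1_def fun_eq_iff power2_eq_square algebra_simps)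
  also have "\<dots> = a ^ 2 * c - 2 * a * b * b + b ^ 2 * a"
    unfolding a_def b_def c_def E_def using int by simp
  finally have "0 \<le> a * (a * c - b ^ 2)"
    by (simp add: algebra_simps power2_eq_square)
  moreover have "a \<ge> 0" unfolding a_def E_def g0_def by (intro Bochner_Integration.integral_nonneg) auto
  \<comment> \<open>In this degenerate case \<open>0 \<le> b \<le> (N + 1) * a\<close> forces
    \<open>b = 0\<close>, which contradicts \<open>strict\<close>.\<close>
  ultimately have "a = 0" using strict by (simp add: zero_le_mult_iff)
  moreover have "b \<le> real (Suc N) * a"
  proof -
    have "b \<le> E (\<lambda>w. real (Suc N) * g0 (S w))"
      unfolding b_def E_def by (intro integral_mono int) (auto simp: g0_def g1_def)
    then show ?thesis unfolding a_def E_def by simp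
  qed
  moreover have "b \<ge> 0" unfolding b_def E_def g1_def by (intro Bochner_Integration.integral_nonneg) auto
  ultimately show False using strict by simp
qed

section \<open>The lower bound for two-point summands\<close>

lemma sum_le_prob_eq:
  "sum_le_prob p I N = measure_pmf.prob (Pi_pmf I 0 p) {w. (\<Sum>i\<in>I. w i) \<le> N}"
proof -
  have "(\<lambda>w. of_bool ((\<Sum>i\<in>I. w i) \<le> N)) = (indicator {w. (\<Sum>i\<in>I. w i) \<le> N} :: _ \<Rightarrow> real)"
    by (auto simp: indicator_def)
  then show ?thesis unfolding sum_le_prob_def sum_expectation_def by simp
qed

text \<open>On the event that the sum is at most \<open>N\<close>, the gap lies between 1 and
  \<open>N + 1\<close>. This and the next lemma confine the ratio \<open>R\<close> to
  \<open>[1, N + 1]\<close>.\<close>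

lemma mean_gap_le: "mean_gap p I N \<le> real (Suc N) * sum_le_prob p I N"
  unfolding mean_gap_def sum_le_prob_def sum_expectation_cmult[symmetric]
  by (rule sum_expectation_mono[where B = "real (Suc N)" and B' = "real (Suc N)"]) auto

lemma sum_le_prob_le_mean_gap: "sum_le_prob p I N \<le> mean_gap p I N"
  unfolding mean_gap_def sum_le_prob_def
  by (rule sum_expectation_mono[where B = 1 and B' = "real (Suc N)"]) auto

text \<open>All summands vanish simultaneously with positive probability, as
  \<open>k i \<ge> 2\<close> gives each the value 0 with probability
  \<open>1 - 1 / k i > 0\<close>.\<close>

lemma sum_le_prob_pos:
  assumes "finite I" "\<And>i. i \<in> I \<Longrightarrow> p i = two_point (k i)" "\<And>i. i \<in> I \<Longrightarrow> k i \<ge> 2"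
  shows "sum_le_prob p I N > 0"
  using assms
proof (induction I)
  case (insert i I)
  have "sum_expectation p I (\<lambda>s. of_bool (k i + s \<le> N)) \<ge> 0"
    unfolding sum_expectation_def by (intro Bochner_Integration.integral_nonneg) auto
  moreover have "(1 - 1 / real (k i)) * sum_le_prob p I N > 0"
  proof (intro mult_pos_pos)
    have "real (k i) > 1" using insert.prems(2)[of i] by simp
    then show "1 - 1 / real (k i) > 0" by simp
  qed (use insert.IH insert.prems in auto)
  moreover have "sum_le_prob p (insert i I) N = (1 - 1 / real (k i)) * sum_le_prob p I N
      + sum_expectation p I (\<lambda>s. of_bool (k i + s \<le> N)) / real (k i)"
    unfolding sum_le_prob_def
    using insert.hyps insert.prems(1)[of i] insert.prems(2)[of i]
    by (intro sum_expectation_insert_two_point[where B = 1]) auto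
  ultimately show ?case by (smt (verit) divide_nonneg_nonneg of_nat_0_le_iff)
qed (simp add: sum_le_prob_def)

text \<open>Induction on the number of summands: a well-chosen deletion preserves the ratio bound
  with the same \<open>R\<close>, and adding the summand back costs at most one
  \<open>gap_step\<close>.\<close>

lemma mean_gap_ge_iterate:
  assumes "finite I" "\<And>i. i \<in> I \<Longrightarrow> p i = two_point (k i)" "\<And>i. i \<in> I \<Longrightarrow> k i \<ge> 2"
    and "R \<ge> 1" "R * sum_le_prob p I N \<le> mean_gap p I N"
  shows "(gap_step R ^^ card I) (real (Suc N)) \<le> mean_gap p I N"
  using assms(1-3,5)
proof (induction "card I" arbitrary: I)
  case 0
  then show ?case by (simp add: mean_gap_def)
next
  case (Suc m)
  then have ne: "I \<noteq> {}" by auto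
  obtain i where i: "i \<in> I"
    "mean_gap p I N * sum_le_prob p (I - {i}) N \<le> mean_gap p (I - {i}) N * sum_le_prob p I N"
    using ex_removal_increasing_gap_ratio[OF Suc.prems(1) ne, of p k N] Suc.prems(2,3) by auto
  define J where "J = I - {i}"
  have J: "I = insert i J" "i \<notin> J" "finite J" "card J = m" "J \<subseteq> I"
    using i(1) Suc.prems(1) Suc.hyps(2) by (auto simp: J_def)
  have pos: "sum_le_prob p I N > 0"
    using Suc.prems by (intro sum_le_prob_pos[where k = k]) auto
  have "sum_le_prob p J N \<ge> 0" by (simp add: sum_le_prob_eq)
  then have "(R * sum_le_prob p I N) * sum_le_prob p J N \<le> mean_gap p I N * sum_le_prob p J N"
    using Suc.prems(4) by (intro mult_right_mono)
  also have "\<dots> \<le> mean_gap p J N * sum_le_prob p I N" using i(2) by (simp add: J_def)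
  finally have "(R * sum_le_prob p J N) * sum_le_prob p I N \<le> mean_gap p J N * sum_le_prob p I N"
    by (simp add: mult_ac)
  then have ratio: "R * sum_le_prob p J N \<le> mean_gap p J N" using pos by simp
  then have "sum_le_prob p J N \<le> mean_gap p J N / R"
    using assms(4) by (simp add: field_simps)
  \<comment> \<open>Together with the preceding bound this gives the minimum occurring in
    \<open>gap_step\<close>.\<close>
  moreover have "sum_le_prob p J N \<le> 1" by (simp add: sum_le_prob_eq)
  moreover have "mean_gap p I N \<ge> mean_gap p J N - sum_le_prob p J N"
    unfolding J(1)
    using J Suc.prems(2)[OF i(1)] Suc.prems(3)[OF i(1)] by (intro mean_gap_insert_ge[where k = "k i"]) auto
  ultimately have "gap_step R (mean_gap p J N) \<le> mean_gap p I N"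
    by (auto simp: gap_step_def)
  moreover have "(gap_step R ^^ m) (real (Suc N)) \<le> mean_gap p J N"
    using Suc.hyps(1)[of J] J Suc.prems(2,3) ratio by auto
  ultimately show ?case
    using gap_step_mono[OF assms(4)] Suc.hyps(2)[symmetric] by (force intro: order_trans)
qed

lemma sum_le_prob_two_point_ge_of_ge_2:
  assumes "finite I" "\<And>i. i \<in> I \<Longrightarrow> p i = two_point (k i)" "\<And>i. i \<in> I \<Longrightarrow> k i \<ge> 2" "card I \<le> N"
  shows "sum_le_prob p I N \<ge> (1 - 1 / real (N + 1)) ^ card I"
proof -
  \<comment> \<open>With the actual ratio as \<open>R\<close>, the ratio hypothesis holds with
    equality and \<open>R\<close> cancels from the final inequality.\<close>
  define R where "R = mean_gap p I N / sum_le_prob p I N"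
  have pos: "sum_le_prob p I N > 0"
    using assms by (intro sum_le_prob_pos[where k = k]) auto
  have gap: "mean_gap p I N = R * sum_le_prob p I N" using pos by (simp add: R_def)
  have R: "1 \<le> R" "R \<le> real (Suc N)"
    using pos sum_le_prob_le_mean_gap[of p I N] mean_gap_le[of p I N] by (simp_all add: R_def divide_le_eq)
  have "R * (1 - 1 / real (Suc N)) ^ card I \<le> (gap_step R ^^ card I) (real (Suc N))"
    using R assms(4) by (intro gap_step_iterate_ge) auto
  also have "\<dots> \<le> R * sum_le_prob p I N"
    using mean_gap_ge_iterate[of I p k R N] assms(1-3) R(1) gap by simp
  finally show ?thesis using R(1) by simp
qed

text \<open>A summand with \<open>k i = 1\<close> is constantly 1, so removing it lowers both the
  threshold and the number of summands by one.\<close>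

lemma sum_le_prob_two_point_ge:
  assumes "finite I" "\<And>i. i \<in> I \<Longrightarrow> p i = two_point (k i)" "\<And>i. i \<in> I \<Longrightarrow> k i \<ge> 1" "card I \<le> N"
  shows "sum_le_prob p I N \<ge> (1 - 1 / real (N + 1)) ^ card I"
  using assms
proof (induction N arbitrary: I)
  case 0
  then show ?case by (simp add: sum_le_prob_def)
next
  case (Suc N)
  show ?case
  proof (cases "\<forall>i\<in>I. k i \<ge> 2")
    case True
    then show ?thesis using Suc.prems by (intro sum_le_prob_two_point_ge_of_ge_2[where k = k]) auto
  next
    case False
    then obtain i where "i \<in> I" "\<not> k i \<ge> 2" by auto
    with Suc.prems(3)[of i] have i: "i \<in> I" "k i = 1" by auto
    define J where "J = I - {i}"
    have J: "I = insert i J" "i \<notin> J" "finite J" "card I = Suc (card J)"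
      using i(1) Suc.prems(1) by (auto simp: J_def card_Suc_Diff1 simp del: card_Diff_insert)
    have card: "real (card J) + 1 \<le> real (Suc N)" using J(4) Suc.prems(4) by linarith
    \<comment> \<open>\<open>power_gap_inequality\<close> with \<open>N + 1\<close> for
      \<open>R\<close> and \<open>N + 2\<close> for \<open>P\<close>: the bound for the smaller
      problem is the stronger one.\<close>
    have "real (Suc N) * (1 - 1 / real (Suc N + 1)) ^ Suc (card J)
        \<le> (real (Suc N + 1) - 1) * (1 - 1 / real (Suc N)) ^ card J"
      using card by (intro power_gap_inequality) auto
    then have "(1 - 1 / real (Suc N + 1)) ^ card I \<le> (1 - 1 / real (N + 1)) ^ card J"
      using J(4) by simp
    also have "\<dots> \<le> sum_le_prob p J N"
      using Suc.IH[of J] J Suc.prems by auto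
    also have "\<dots> = sum_le_prob p I (Suc N)"
      unfolding sum_le_prob_def J(1)
      using sum_expectation_insert_two_point[OF J(3,2), of "\<lambda>s. of_bool (s \<le> Suc N)" 1 p 1]
        Suc.prems(2)[OF i(1)] i(2) by simp
    finally show ?thesis .
  qed
qed

section \<open>Arbitrary summands of mean one\<close>

text \<open>\<open>K\<close> holds the indices whose laws may still be arbitrary. The induction
  varies \<open>p\<close>, so that the hypothesis applies after one law has been replaced by any
  \<open>two_point k\<close>.\<close>

lemma sum_le_prob_ge:
  assumes "finite I" "\<And>i. i \<in> I \<Longrightarrow> nat_pmf_mean (p i) = 1" "card I \<le> N"
  shows "sum_le_prob p I N \<ge> (1 - 1 / real (N + 1)) ^ card I"
proof -
  have "sum_le_prob p I N \<ge> (1 - 1 / real (N + 1)) ^ card I"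
    if "finite K" "K \<subseteq> I" "\<And>i. i \<in> I \<Longrightarrow> nat_pmf_mean (p i) = 1"
      "\<And>i. i \<in> I - K \<Longrightarrow> \<exists>k\<ge>1. p i = two_point k" for K p
    using that
  proof (induction K arbitrary: p)
    case empty
    then obtain k where "\<And>i. i \<in> I \<Longrightarrow> k i \<ge> 1 \<and> p i = two_point (k i)" by (metis Diff_empty)
    then show ?case using assms(1,3) by (intro sum_le_prob_two_point_ge[where k = k]) auto
  next
    case (insert i K)
    define J where "J = I - {i}"
    have J: "I = insert i J" "i \<notin> J" "finite J"
      using insert.prems(1) assms(1) by (auto simp: J_def)
    define f where "f = (\<lambda>x. sum_expectation p J (\<lambda>s. of_bool (x + s \<le> N)))"
    \<comment> \<open>By independence the probability is linear in the law of summand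
      \<open>i\<close>, with an integrand \<open>f\<close> that does not depend on that law.\<close>
    have split: "sum_le_prob (p(i := q)) I N = measure_pmf.expectation q f" for q
    proof -
      have "Pi_pmf J 0 (p(i := q)) = Pi_pmf J 0 p"
        using J(2) by (intro Pi_pmf_cong) auto
      then show ?thesis
        unfolding sum_le_prob_def J(1) f_def
        using J by (subst sum_expectation_insert[where B = 1]) (auto simp: sum_expectation_def)
    qed
    have "(1 - 1 / real (N + 1)) ^ card I \<le> measure_pmf.expectation (p i) f"
    proof (rule expectation_ge_supporting_line[where B = 1])
      show "\<bar>f x\<bar> \<le> 1" for x
      proof -
        have "f x \<le> sum_expectation p J (\<lambda>_. 1)"
          unfolding f_def by (rule sum_expectation_mono[where B = 1 and B' = 1]) auto
        moreover have "f x \<ge> 0"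
          unfolding f_def sum_expectation_def by (intro Bochner_Integration.integral_nonneg) auto
        ultimately show ?thesis by (simp add: sum_expectation_def)
      qed
    next
      fix k :: nat assume k: "k \<ge> 1"
      have "(1 - 1 / real (N + 1)) ^ card I \<le> sum_le_prob (p(i := two_point k)) I N"
      proof (rule insert.IH)
        show "nat_pmf_mean ((p(i := two_point k)) j) = 1" if "j \<in> I" for j
          using that insert.prems(2)[of j] nat_pmf_mean_two_point[OF k] by auto
        show "\<exists>l\<ge>1. (p(i := two_point k)) j = two_point l" if "j \<in> I - K" for j
          using that k insert.prems(3)[of j] by (cases "j = i") auto
      qed (use insert.prems in auto)
      then show "(1 - 1 / real (N + 1)) ^ card I \<le> measure_pmf.expectation (two_point k) f"
        by (simp only: split)
    qed (use insert.prems in auto)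
    then show ?case using split[of "p i"] by simp
  qed
  from this[of I p] show ?thesis using assms by auto
qed

section \<open>Identically distributed summands and the extremal law\<close>

lemma prob_iid_sum_pmf:
  "measure_pmf.prob (iid_sum_pmf n p) {..N} = sum_le_prob (\<lambda>_. p) {..<n} N"
  by (simp add: iid_sum_pmf_def sum_le_prob_eq vimage_def)

text \<open>A single nonzero summand equals \<open>N + 1\<close> and already exceeds the threshold,
  so almost surely the event says that all \<open>n\<close> summands vanish.\<close>

lemma prob_iid_sum_extremal_pmf:
  "measure_pmf.prob (iid_sum_pmf n (extremal_pmf N)) {..N} = (1 - 1 / real (N + 1)) ^ n"
proof -
  let ?q = "extremal_pmf N"
  have q0: "measure_pmf.prob ?q {0} = 1 - 1 / real (N + 1)"
  proof -
    have "(\<lambda>b. if b then N + 1 else 0) -` {0} = {False}" by auto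
    then show ?thesis
      by (simp only: extremal_pmf_def measure_map_pmf) (simp add: measure_pmf_single)
  qed
  have "sum_le_prob (\<lambda>_. ?q) {..<n} N
      = measure_pmf.prob (Pi_pmf {..<n} 0 (\<lambda>_. ?q)) (PiE_dflt {..<n} 0 (\<lambda>_. {0}))"
    unfolding sum_le_prob_eq
  proof (rule measure_pmf.finite_measure_eq_AE)
    show "AE w in measure_pmf (Pi_pmf {..<n} 0 (\<lambda>_. ?q)).
        (w \<in> {w. (\<Sum>i<n. w i) \<le> N}) = (w \<in> PiE_dflt {..<n} 0 (\<lambda>_. {0}))"
    proof (subst AE_measure_pmf_iff, intro ballI)
      fix w assume "w \<in> set_pmf (Pi_pmf {..<n} 0 (\<lambda>_. ?q))"
      then have w: "w i \<in> {0, N + 1}" "\<not> i < n \<Longrightarrow> w i = 0" for i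
        by (auto simp: set_Pi_pmf PiE_dflt_def extremal_pmf_def)
      have "w i = 0" if "(\<Sum>i<n. w i) \<le> N" "i < n" for i
      proof -
        have "w i \<le> (\<Sum>i<n. w i)" using that(2) by (intro member_le_sum) auto
        then show ?thesis using that(1) w(1)[of i] by auto
      qed
      then show "(w \<in> {w. (\<Sum>i<n. w i) \<le> N}) = (w \<in> PiE_dflt {..<n} 0 (\<lambda>_. {0}))"
        using w(2) by (auto simp: PiE_dflt_def)
    qed
  qed auto
  also have "\<dots> = (1 - 1 / real (N + 1)) ^ n"
    by (subst measure_Pi_pmf_PiE_dflt) (simp_all add: q0)
  finally show ?thesis by (simp add: prob_iid_sum_pmf)
qed

theorem mainTheorem5:
  fixes n :: nat
  assumes "n \<ge> 2"
  shows "(\<forall>p. nat_pmf_mean p = 1 \<longrightarrow>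
            measure_pmf.prob (iid_sum_pmf n p) {..n} \<ge> (1 - 1 / real (n + 1)) ^ n)
       \<and> nat_pmf_mean (extremal_pmf n) = 1
       \<and> measure_pmf.prob (iid_sum_pmf n (extremal_pmf n)) {..n} = (1 - 1 / real (n + 1)) ^ n"
proof (intro conjI allI impI)
  fix p assume "nat_pmf_mean p = 1"
  then show "measure_pmf.prob (iid_sum_pmf n p) {..n} \<ge> (1 - 1 / real (n + 1)) ^ n"
    using sum_le_prob_ge[of "{..<n}" "\<lambda>_. p" n] by (simp add: prob_iid_sum_pmf)
next
  have "extremal_pmf n = two_point (n + 1)" by (simp only: extremal_pmf_def two_point_def)
  then show "nat_pmf_mean (extremal_pmf n) = 1" by (simp only: nat_pmf_mean_two_point le_add2)
qed (rule prob_iid_sum_extremal_pmf)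

end
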